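(* Let $(S,\leq,{}^*,\vee)$ be a separation system with a corner map that is orderly with respect to a set $\mathcal{P}$ of closed profiles of $(S,\leq,{}^*,\vee)$. Then there is a tree set $T\subseteq S$ with the following properties: (1) Any two different elements of $\mathcal{P}$ are distinguished by some element of $T$. (2) Any element of $T$ distinguishes some two elements of $\mathcal{P}$. (3) For every $P\in\mathcal{P}$, every separation in $P\cap T$ lies below (is less than or equal to) some maximal element of $P\cap T$.
   Context: A separation system $(S,\leq,{}^* )$ is a partially ordered set with an order-reversing involution ${}^*$; its elements are called separations. A corner map on $S$ is a map $\vee$ from a subset of $S\times S$ to $S$ such that (i) if $s\leq t$, then $\vee(s,t)$ is defined, and (ii) if $\vee(s,t)$ is defined, then $\vee(t,s)$ is also defined and $\vee(s,t)$ is the supremum of $s$ and $t$ in $\leq$. One writes $s\vee t$ for $\vee(s,t)$. An orientation of $S$ is a subset $O\subseteq S$ that contains, for every $s\in S$, exactly one element of the set $\{s,s^*\}$. It is consistent if there are no $r,s\in S$ with $r<s$, $r\neq s^*$, $r^*\in O$ and $s\in O$. A profile of a separation system with corner map is a consistent orientation $P$ of $S$ such that for all $s,t\in P$, if $s\vee t$ is defined then $(s\vee t)^*\notin P$. A profile $P$ is closed (in $S$) if for every nonempty $\leq$-chain in $P$ the supremum with respect to $\leq$ exists in $S$ and is contained in $P$. The system is orderly with respect to a set $\mathcal{P}$ of profiles if for all $s,t\in S$ such that some profile in $\mathcal{P}$ contains $s$ and $t$ and some profile in $\mathcal{P}$ contains $s^*$ and $t^*$, both $s\vee t$ and $s^*\vee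 t^*$ are defined. A separation $s$ distinguishes profiles $P$ and $Q$ if $s\neq s^*$ and one of $s,s^*$ lies in $P$ and the other one in $Q$. Two separations $s,t$ are nested if one of $s,s^*$ is comparable with one of $t,t^*$. A separation $s$ of a separation system is degenerate if $s=s^*$, and trivial if there is $r$ in that system with $s<r$ and $s<r^*$. A tree set is a separation system whose elements are pairwise nested and none of whose elements is trivial (in it) or degenerate; a tree set $T\subseteq S$ is a subset closed under ${}^*$ that is a tree set with the induced order and involution. *)

theory Defs
  imports Main
begin

locale separation_system =
  fixes S :: "'a set"
    and le :: "'a \<Rightarrow> 'a \<Rightarrow> bool"
    and star :: "'a \<Rightarrow> 'a"
  assumes refl: "reflp_on S le"
    and antisym: "antisymp_on S le"
    and trans: "transp_on S le"
    and star_closed: "s \<in> S \<Longrightarrow> star s \<in> S"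
    and star_star: "s \<in> S \<Longrightarrow> star (star s) = s"
    and star_antimono: "monotone_on S le (\<lambda>s t. le t s) star"

definition strictly_below :: "('a \<Rightarrow> 'a \<Rightarrow> bool) \<Rightarrow> 'a \<Rightarrow> 'a \<Rightarrow> bool" where
  "strictly_below le s t \<longleftrightarrow> le s t \<and> s \<noteq> t"

definition supremum_in :: "'a set \<Rightarrow> ('a \<Rightarrow> 'a \<Rightarrow> bool) \<Rightarrow> 'a set \<Rightarrow> 'a \<Rightarrow> bool" where
  "supremum_in S le A x \<longleftrightarrow>
     x \<in> S \<and> (\<forall>a\<in>A. le a x) \<and> (\<forall>y\<in>S. (\<forall>a\<in>A. le a y) \<longrightarrow> le x y)"

definition maximal_in :: "('a \<Rightarrow> 'a \<Rightarrow> bool) \<Rightarrow> 'a set \<Rightarrow> 'a \<Rightarrow> bool" where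
  "maximal_in le A m \<longleftrightarrow> m \<in> A \<and> (\<forall>a\<in>A. le m a \<longrightarrow> a = m)"

text \<open>A corner map is partial: \<open>vee (s, t) = None\<close> means that the corner of \<open>s\<close> and \<open>t\<close> is
  undefined, even if \<open>s\<close> and \<open>t\<close> have a supremum.\<close>

locale separation_system_corner = separation_system S le star
  for S :: "'a set" and le :: "'a \<Rightarrow> 'a \<Rightarrow> bool" and star :: "'a \<Rightarrow> 'a" +
  fixes vee :: "'a \<times> 'a \<rightharpoonup> 'a"
  assumes dom_vee: "dom vee \<subseteq> S \<times> S"
    and vee_defined: "\<lbrakk>s \<in> S; t \<in> S; le s t\<rbrakk> \<Longrightarrow> (s, t) \<in> dom vee"
    and vee_sym: "(s, t) \<in> dom vee \<Longrightarrow> (t, s) \<in> dom vee"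
    and vee_sup: "vee (s, t) = Some u \<Longrightarrow> supremum_in S le {s, t} u"

definition orientation :: "'a set \<Rightarrow> ('a \<Rightarrow> 'a) \<Rightarrow> 'a set \<Rightarrow> bool" where
  "orientation S star Or \<longleftrightarrow> Or \<subseteq> S \<and> (\<forall>s\<in>S. \<exists>!x. x \<in> {s, star s} \<and> x \<in> Or)"

definition consistent ::
  "'a set \<Rightarrow> ('a \<Rightarrow> 'a \<Rightarrow> bool) \<Rightarrow> ('a \<Rightarrow> 'a) \<Rightarrow> 'a set \<Rightarrow> bool" where
  "consistent S le star Or \<longleftrightarrow>
     \<not> (\<exists>r\<in>S. \<exists>s\<in>S. strictly_below le r s \<and> r \<noteq> star s \<and> star r \<in> Or \<and> s \<in> Or)"

definition profile ::
  "'a set \<Rightarrow> ('a \<Rightarrow> 'a \<Rightarrow> bool) \<Rightarrow> ('a \<Rightarrow> 'a) \<Rightarrow> ('a \<times> 'a \<rightharpoonup> 'a) \<Rightarrow> 'a set \<Rightarrow> bool" where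
  "profile S le star vee P \<longleftrightarrow>
     orientation S star P \<and> consistent S le star P \<and>
     (\<forall>s\<in>P. \<forall>t\<in>P. \<forall>u. vee (s, t) = Some u \<longrightarrow> star u \<notin> P)"

definition closed_in :: "'a set \<Rightarrow> ('a \<Rightarrow> 'a \<Rightarrow> bool) \<Rightarrow> 'a set \<Rightarrow> bool" where
  "closed_in S le P \<longleftrightarrow>
     (\<forall>C. C \<noteq> {} \<and> C \<subseteq> P \<and> Complete_Partial_Order.chain le C \<longrightarrow> (\<exists>x\<in>P. supremum_in S le C x))"

definition orderly ::
  "'a set \<Rightarrow> ('a \<Rightarrow> 'a) \<Rightarrow> ('a \<times> 'a \<rightharpoonup> 'a) \<Rightarrow> 'a set set \<Rightarrow> bool" where
  "orderly S star vee Ps \<longleftrightarrow>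
     (\<forall>s\<in>S. \<forall>t\<in>S. (\<exists>P\<in>Ps. s \<in> P \<and> t \<in> P) \<and> (\<exists>Q\<in>Ps. star s \<in> Q \<and> star t \<in> Q) \<longrightarrow>
        (s, t) \<in> dom vee \<and> (star s, star t) \<in> dom vee)"

definition distinguishes :: "('a \<Rightarrow> 'a) \<Rightarrow> 'a \<Rightarrow> 'a set \<Rightarrow> 'a set \<Rightarrow> bool" where
  "distinguishes star s P Q \<longleftrightarrow>
     s \<noteq> star s \<and> (s \<in> P \<and> star s \<in> Q \<or> star s \<in> P \<and> s \<in> Q)"

definition nested :: "('a \<Rightarrow> 'a \<Rightarrow> bool) \<Rightarrow> ('a \<Rightarrow> 'a) \<Rightarrow> 'a \<Rightarrow> 'a \<Rightarrow> bool" where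
  "nested le star s t \<longleftrightarrow> (\<exists>x\<in>{s, star s}. \<exists>y\<in>{t, star t}. le x y \<or> le y x)"

definition degenerate :: "('a \<Rightarrow> 'a) \<Rightarrow> 'a \<Rightarrow> bool" where
  "degenerate star s \<longleftrightarrow> s = star s"

definition trivial_in ::
  "'a set \<Rightarrow> ('a \<Rightarrow> 'a \<Rightarrow> bool) \<Rightarrow> ('a \<Rightarrow> 'a) \<Rightarrow> 'a \<Rightarrow> bool" where
  "trivial_in T le star s \<longleftrightarrow> (\<exists>r\<in>T. strictly_below le s r \<and> strictly_below le s (star r))"

text \<open>The order and involution induced on a subset \<open>T\<close> of \<open>S\<close> are given by the same \<open>le\<close> and \<open>star\<close>,
  with \<open>T\<close> as the carrier; \<open>separation_system T le star\<close> includes closure of \<open>T\<close> under \<open>star\<close>.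
  Triviality is relative to \<open>T\<close>, not to \<open>S\<close>.\<close>

definition tree_set :: "'a set \<Rightarrow> ('a \<Rightarrow> 'a \<Rightarrow> bool) \<Rightarrow> ('a \<Rightarrow> 'a) \<Rightarrow> bool" where
  "tree_set T le star \<longleftrightarrow>
     separation_system T le star \<and>
     (\<forall>s\<in>T. \<forall>t\<in>T. nested le star s t) \<and>
     (\<forall>s\<in>T. \<not> trivial_in T le star s \<and> \<not> degenerate star s)"

end

theory Submission
  imports Defs
begin

text \<open>
  Take \<open>T\<close> to be a maximal set of pairwise nested separations that each distinguish two profiles
  of \<open>Ps\<close>. Such a \<open>T\<close> exists by Zorn's lemma, and consistency rules out trivial elements, so what
  needs an argument is that every maximal \<open>T\<close> has properties (1) and (3).

  The engine is lemma \<open>nested_supremum\<close>: nestedness with a fixed separation survives suprema of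
  chains, and also the supremum of two crossing separations. Moreover, if \<open>c \<le> x\<close> both lie in
  \<open>P\<close> and \<open>c\<close> distinguishes \<open>P\<close> from \<open>Q\<close>, then so does \<open>x\<close>. Hence the supremum in a closed profile
  \<open>P\<close> of a chain of \<open>P \<inter> T\<close> is nested with \<open>T\<close> and distinguishes two profiles, so it lies in \<open>T\<close> by
  maximality. Property (3) is then Zorn's lemma inside \<open>P \<inter> T\<close>.

  For (1), suppose that no element of \<open>T\<close> distinguishes \<open>P\<close> from \<open>Q\<close>. Choose \<open>s\<close> maximal in \<open>P\<close> with
  \<open>s\<^sup>* \<in> Q\<close>, and then, above \<open>s\<^sup>*\<close>, a separation \<open>y\<close> that is maximal among the elements of \<open>Q\<close> that
  are nested with every element of \<open>T\<close> with which \<open>s\<close> is nested. If \<open>y\<close> crosses some \<open>t \<in> T\<close>, then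
  so does \<open>s\<close>. After replacing \<open>t\<close> by its inverse, \<open>t\<close> lies in \<open>P\<close> and \<open>Q\<close>, and \<open>t\<^sup>*\<close> lies in some
  profile \<open>R\<close> because \<open>t\<close> distinguishes two profiles. If \<open>s\<^sup>* \<in> R\<close>, then orderliness gives
  \<open>s \<or> t \<in> P\<close>, against the maximality of \<open>s\<close>. So \<open>s \<in> R\<close>, hence \<open>y\<^sup>* \<le> s\<close> lies in \<open>R\<close>, and
  orderliness gives \<open>y \<or> t \<in> Q\<close>, against the maximality of \<open>y\<close>. The order of the two choices matters:
  the first one decides how every such \<open>R\<close> orients \<open>s\<close>, so that in the second one all corrections
  go in the same direction and infinitely many of them can be made in a closed profile.
\<close>

section \<open>Nestedness\<close>

context separation_system
begin

lemma le_refl: "s \<in> S \<Longrightarrow> le s s"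
  using refl by (simp add: reflp_onD)

lemma le_antisym: "\<lbrakk>le s t; le t s; s \<in> S; t \<in> S\<rbrakk> \<Longrightarrow> s = t"
  using antisym by (simp add: antisymp_onD)

lemma le_trans: "\<lbrakk>le r s; le s t; r \<in> S; s \<in> S; t \<in> S\<rbrakk> \<Longrightarrow> le r t"
  using trans by (meson transp_onD)

lemma star_le: "\<lbrakk>le s t; s \<in> S; t \<in> S\<rbrakk> \<Longrightarrow> le (star t) (star s)"
  using star_antimono by (simp add: monotone_on_def)

lemma nested_iff:
  assumes "s \<in> S" "t \<in> S"
  shows "nested le star s t \<longleftrightarrow> le s t \<or> le s (star t) \<or> le t s \<or> le (star t) s"
  unfolding nested_def
  using assms star_le star_closed star_star by (auto; metis)

lemma nested_star_left:
  assumes "s \<in> S"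
  shows "nested le star (star s) t \<longleftrightarrow> nested le star s t"
  unfolding nested_def using assms star_star by auto

lemma nested_star_right:
  assumes "t \<in> S"
  shows "nested le star s (star t) \<longleftrightarrow> nested le star s t"
  unfolding nested_def using assms star_star by auto

lemma nested_commute: "nested le star s t \<longleftrightarrow> nested le star t s"
  unfolding nested_def by blast

text \<open>If some \<open>c \<in> C\<close> lies above \<open>u\<close> or its inverse, so does the supremum. Otherwise every element of
  \<open>C\<close> lies below \<open>u\<close> or below its inverse, and the point is that the same choice works for all of
  \<open>C\<close>: \<open>a \<le> u\<close> and \<open>b \<le> u\<^sup>*\<close> give \<open>a \<le> b\<^sup>*\<close>, so \<open>a\<close> and \<open>b\<close> are comparable and one choice serves both.
  The condition on \<open>C\<close> covers both chains and pairs of crossing separations.\<close>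

lemma nested_supremum:
  assumes "u \<in> S" "C \<subseteq> S" "supremum_in S le C x"
    and comp: "\<And>a b. \<lbrakk>a \<in> C; b \<in> C; le a (star b)\<rbrakk> \<Longrightarrow> le a b \<or> le b a"
    and nest: "\<And>c. c \<in> C \<Longrightarrow> nested le star c u"
  shows "nested le star x u"
proof -
  have x: "x \<in> S" and ub: "\<And>c. c \<in> C \<Longrightarrow> le c x"
    and least: "\<And>y. \<lbrakk>y \<in> S; \<And>c. c \<in> C \<Longrightarrow> le c y\<rbrakk> \<Longrightarrow> le x y"
    using assms(3) unfolding supremum_in_def by auto
  have us: "star u \<in> S" using assms(1) star_closed by blast
  consider (above) c where "c \<in> C" "le u c \<or> le (star u) c"
    | (below) "\<forall>c\<in>C. le c u \<or> le c (star u)"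
    using nest assms(1,2) nested_iff by (meson subsetD)
  then show ?thesis
  proof cases
    case above
    then have "le u x \<or> le (star u) x"
      using ub[of c] le_trans[of u c x] le_trans[of "star u" c x] assms(1,2) us x by auto
    then show ?thesis using nested_iff[OF x assms(1)] by blast
  next
    case below
    have "(\<forall>c\<in>C. le c u) \<or> (\<forall>c\<in>C. le c (star u))"
    proof (rule ccontr)
      assume "\<not> ?thesis"
      then obtain a b where ab: "a \<in> C" "b \<in> C" "\<not> le a (star u)" "\<not> le b u" by blast
      then have "le a u" "le b (star u)" using below by blast+
      have S: "a \<in> S" "b \<in> S" using ab assms(2) by auto
      have "le u (star b)"
        using star_le[OF \<open>le b (star u)\<close> S(2) us] star_star[OF assms(1)] by simp
      then have "le a (star b)"
        using le_trans[OF \<open>le a u\<close>] S assms(1) star_closed by blast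
      then have "le a b \<or> le b a" using comp ab by blast
      then show False
        using le_trans[of a b "star u"] le_trans[of b a u] \<open>le a u\<close> \<open>le b (star u)\<close> ab S us assms(1)
        by blast
    qed
    then have "le x u \<or> le x (star u)" using least us assms(1) by blast
    then show ?thesis using nested_iff[OF x assms(1)] by blast
  qed
qed

lemma nested_chain_supremum:
  assumes "u \<in> S" "C \<subseteq> S" "Complete_Partial_Order.chain le C" "supremum_in S le C x"
    and "\<And>c. c \<in> C \<Longrightarrow> nested le star c u"
  shows "nested le star x u"
  using assms by (intro nested_supremum[of u C x]) (auto dest: chainD)

lemma nested_corner:
  assumes "u \<in> S" "s \<in> S" "t \<in> S" "supremum_in S le {s, t} x" "\<not> nested le star s t"
    and "nested le star s u" "nested le star t u"
  shows "nested le star x u"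
proof (rule nested_supremum[OF assms(1) _ assms(4)])
  show "le a b \<or> le b a" if "a \<in> {s, t}" "b \<in> {s, t}" "le a (star b)" for a b
  proof -
    have "\<not> le s (star t)" "\<not> le t (star s)"
      using assms(2,3,5) nested_iff nested_commute by blast+
    then show ?thesis using that le_refl assms(2,3) by auto
  qed
qed (use assms in auto)

text \<open>Zorn's lemma in a closed profile. It is stated for subsets \<open>A\<close> because it is applied to the
  profile itself, to its intersection with a nested set, and to a set of candidates with prescribed
  nestedness.\<close>

lemma closed_above_maximal:
  assumes P: "P \<subseteq> S" "closed_in S le P" and A: "A \<subseteq> P" "s \<in> A"
    and sup: "\<And>C x. \<lbrakk>C \<noteq> {}; C \<subseteq> A; Complete_Partial_Order.chain le C; x \<in> P;
                supremum_in S le C x\<rbrakk> \<Longrightarrow> x \<in> A"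
  shows "\<exists>m. maximal_in le A m \<and> le s m"
proof -
  define B where "B = {a \<in> A. le s a}"
  have B: "B \<subseteq> S" "B \<subseteq> A" "s \<in> B" using P A le_refl by (auto simp: B_def)
  have "partial_order_on B (relation_of le B)"
    using B(1) by (intro partial_order_on_relation_ofI) (blast intro: le_refl le_trans le_antisym)+
  moreover have "\<exists>u\<in>B. \<forall>a\<in>C. le a u" if "C \<in> Chains (relation_of le B)" for C
  proof (cases "C = {}")
    case True
    then show ?thesis using B by blast
  next
    case False
    have C: "C \<subseteq> B" using that False by (auto simp: Chains_def relation_of_def)
    have "Complete_Partial_Order.chain le C"
      using that by (auto simp: Chains_def relation_of_def Complete_Partial_Order.chain_def)
    then obtain x where x: "x \<in> P" "supremum_in S le C x"
      using P(2) C B A False unfolding closed_in_def by (meson subset_trans)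
    then have "x \<in> A" using sup C B False \<open>Complete_Partial_Order.chain le C\<close> by (meson subset_trans)
    moreover obtain c where "c \<in> C" using False by blast
    moreover have "\<forall>c\<in>C. le c x" using x by (simp add: supremum_in_def)
    ultimately have "le s x"
      using le_trans[of s c x] C B P A x(1) by (auto simp: B_def)
    then show ?thesis using \<open>x \<in> A\<close> \<open>\<forall>c\<in>C. le c x\<close> by (auto simp: B_def)
  qed
  ultimately obtain m where m: "m \<in> B" "\<forall>a\<in>B. le m a \<longrightarrow> a = m"
    using predicate_Zorn[of B le] by blast
  have "a = m" if "a \<in> A" "le m a" for a
  proof -
    have "le s a" using le_trans[of s m a] that m(1) B P A by (auto simp: B_def)
    then show ?thesis using m that by (auto simp: B_def)
  qed
  then show ?thesis using m(1) by (auto simp: B_def maximal_in_def)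
qed

lemma separation_system_subset:
  assumes "T \<subseteq> S" "\<And>t. t \<in> T \<Longrightarrow> star t \<in> T"
  shows "separation_system T le star"
proof
  show "monotone_on T le (\<lambda>s t. le t s) star"
    using star_antimono assms(1) by (rule monotone_on_subset)
  show "reflp_on T le" using refl assms(1) by (rule reflp_on_subset)
  show "antisymp_on T le" using antisym assms(1) by (rule antisymp_on_subset)
  show "transp_on T le" using trans assms(1) by (rule transp_on_subset)
qed (use assms star_star in auto)

end

section \<open>Profiles\<close>

context separation_system_corner
begin

lemma profile_subset: "profile S le star vee P \<Longrightarrow> P \<subseteq> S"
  by (simp add: profile_def orientation_def)

lemma profile_total:
  "\<lbrakk>profile S le star vee P; s \<in> S\<rbrakk> \<Longrightarrow> s \<in> P \<or> star s \<in> P"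
  unfolding profile_def orientation_def by (metis insertE singletonD)

text \<open>The orientation axiom does not exclude a degenerate \<open>s \<in> P\<close>; but \<open>s \<or> s = s\<close> is defined, so the
  profile axiom forbids \<open>s\<^sup>* = s \<in> P\<close>. Profiles therefore exist only when nothing is degenerate.\<close>

lemma profile_not_both:
  assumes P: "profile S le star vee P" and s: "s \<in> P"
  shows "star s \<notin> P"
proof (cases "star s = s")
  case True
  have sS: "s \<in> S" using assms profile_subset by blast
  then obtain u where u: "vee (s, s) = Some u"
    using vee_defined[OF sS sS le_refl[OF sS]] by blast
  then have "le s u" "le u s" "u \<in> S"
    using vee_sup[OF u] sS le_refl by (auto simp: supremum_in_def)
  then have "u = s" using le_antisym sS by blast
  then show ?thesis using P s u unfolding profile_def by blast
next
  case False
  have "s \<in> S" using assms profile_subset by blast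
  then show ?thesis
    using P s False unfolding profile_def orientation_def by (metis insertCI)
qed

text \<open>A consistent orientation is closed downwards except that \<open>s\<^sup>* \<le> s\<close> can occur with \<open>s \<in> P\<close>.\<close>

lemma profile_downward:
  assumes "profile S le star vee P" "s \<in> P" "r \<in> S" "le r s" "r \<noteq> star s"
  shows "r \<in> P"
proof (rule ccontr)
  assume "r \<notin> P"
  then have "star r \<in> P" "r \<noteq> s" using assms profile_total by blast+
  moreover have "s \<in> S" using assms profile_subset by blast
  ultimately show False
    using assms unfolding profile_def consistent_def strictly_below_def by blast
qed

lemma profile_distinguish_upward:
  assumes P: "profile S le star vee P" and Q: "profile S le star vee Q"
    and "c \<in> P" "star c \<in> Q" "x \<in> P" "le c x"
  shows "star x \<in> Q"
proof (rule ccontr)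
  have S: "c \<in> S" "x \<in> S" using assms profile_subset by blast+
  assume "star x \<notin> Q"
  then have "x \<in> Q" using profile_total[OF Q S(2)] by blast
  moreover have "c \<noteq> star x" using profile_not_both[OF P] assms by blast
  ultimately have "c \<in> Q" using profile_downward[OF Q] S assms by blast
  then show False using profile_not_both[OF Q] assms by blast
qed

lemma profile_corner:
  assumes P: "profile S le star vee P" and "s \<in> P" "t \<in> P" "(s, t) \<in> dom vee"
  shows "\<exists>u\<in>P. supremum_in S le {s, t} u"
proof -
  obtain u where u: "vee (s, t) = Some u" using assms by blast
  then have sup: "supremum_in S le {s, t} u" by (rule vee_sup)
  then have "u \<in> S" by (simp add: supremum_in_def)
  moreover have "star u \<notin> P" using P assms u unfolding profile_def by blast
  ultimately show ?thesis using profile_total[OF P] sup by blast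
qed

lemma profiles_differ_distinguished:
  assumes P: "profile S le star vee P" and Q: "profile S le star vee Q" and "P \<noteq> Q"
  shows "\<exists>s. s \<in> P \<and> star s \<in> Q"
proof (rule ccontr)
  assume "\<not> ?thesis"
  then have sub: "P \<subseteq> Q" using profile_total[OF Q] profile_subset[OF P] by blast
  have "Q \<subseteq> P"
  proof
    fix s assume s: "s \<in> Q"
    then have "star s \<notin> P" using profile_not_both[OF Q] sub by blast
    then show "s \<in> P" using profile_total[OF P] profile_subset[OF Q] s by blast
  qed
  then show False using sub assms(3) by blast
qed

end

section \<open>Distinguishing two profiles by a separation nested with a given set\<close>

definition relevant :: "'a set set \<Rightarrow> ('a \<Rightarrow> 'a) \<Rightarrow> 'a \<Rightarrow> bool" where
  "relevant Ps star s \<longleftrightarrow> (\<exists>P\<in>Ps. \<exists>Q\<in>Ps. s \<in> P \<and> star s \<in> Q)"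

locale orderly_closed_profiles = separation_system_corner S le star vee
  for S :: "'a set" and le :: "'a \<Rightarrow> 'a \<Rightarrow> bool" and star :: "'a \<Rightarrow> 'a"
    and vee :: "'a \<times> 'a \<rightharpoonup> 'a" +
  fixes Ps :: "'a set set"
  assumes profiles: "P \<in> Ps \<Longrightarrow> profile S le star vee P"
    and closed: "P \<in> Ps \<Longrightarrow> closed_in S le P"
    and orderly: "orderly S star vee Ps"
begin

lemma orderly_corner:
  assumes "P \<in> Ps" "Q \<in> Ps" "s \<in> P" "t \<in> P" "star s \<in> Q" "star t \<in> Q"
  shows "\<exists>u\<in>P. supremum_in S le {s, t} u"
proof -
  have "s \<in> S" "t \<in> S" using assms profiles profile_subset by blast+
  then have "(s, t) \<in> dom vee" using assms orderly unfolding orderly_def by blast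
  then show ?thesis using assms profiles profile_corner by blast
qed

lemma relevant_in_S: "relevant Ps star s \<Longrightarrow> s \<in> S"
  using profiles profile_subset unfolding relevant_def by blast

lemma relevant_star: "relevant Ps star s \<Longrightarrow> relevant Ps star (star s)"
  using star_star[OF relevant_in_S] unfolding relevant_def by auto

lemma relevant_upward:
  assumes "relevant Ps star c" "P \<in> Ps" "c \<in> P" "x \<in> P" "le c x"
  shows "relevant Ps star x"
  using assms profiles profile_distinguish_upward unfolding relevant_def by meson

text \<open>This is where a set that fails to distinguish \<open>P\<close> from \<open>Q\<close> turns out not to be maximal. Starting
  from \<open>s\<^sup>* \<in> Q\<close>, the crossings are removed by going up inside \<open>Q\<close>. Nothing above \<open>s\<^sup>*\<close> in \<open>Q\<close> stops
  distinguishing \<open>P\<close> from \<open>Q\<close>, so the only thing to maintain on the way is that no new crossings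
  arise.\<close>

lemma nested_distinguisher_exists:
  assumes T: "\<And>t. t \<in> T \<Longrightarrow> relevant Ps star t" "\<And>t. t \<in> T \<Longrightarrow> star t \<in> T"
      "\<And>t u. \<lbrakk>t \<in> T; u \<in> T\<rbrakk> \<Longrightarrow> nested le star t u"
    and PQ: "P \<in> Ps" "Q \<in> Ps" "P \<noteq> Q"
    and same: "T \<inter> P \<subseteq> Q"
  shows "\<exists>y. y \<in> Q \<and> star y \<in> P \<and> (\<forall>t\<in>T. nested le star y t)"
proof -
  note P = profiles[OF PQ(1)] and Q = profiles[OF PQ(2)]
  note PS = profile_subset[OF P] and QS = profile_subset[OF Q]
  have TS: "T \<subseteq> S" using T(1) relevant_in_S by blast
  obtain s0 where s0: "s0 \<in> P" "star s0 \<in> Q"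
    using profiles_differ_distinguished[OF P Q PQ(3)] by blast
  then obtain s where s: "maximal_in le P s" "le s0 s"
    using closed_above_maximal[OF PS closed[OF PQ(1)], of P s0] by blast
  have sP: "s \<in> P" and smax: "\<And>a. \<lbrakk>a \<in> P; le s a\<rbrakk> \<Longrightarrow> a = s"
    using s(1) by (auto simp: maximal_in_def)
  have sQ: "star s \<in> Q" using profile_distinguish_upward[OF P Q s0 sP s(2)] .
  have sS: "s \<in> S" using sP PS by blast
  define A where
    "A = {y \<in> Q. le (star s) y \<and> (\<forall>t\<in>T. nested le star s t \<longrightarrow> nested le star y t)}"
  have AQ: "A \<subseteq> Q" by (auto simp: A_def)
  have "star s \<in> A"
    using sQ QS le_refl nested_star_left[OF sS] by (auto simp: A_def)
  moreover have "x \<in> A" if C: "C \<noteq> {}" "C \<subseteq> A" "Complete_Partial_Order.chain le C"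
    and x: "x \<in> Q" "supremum_in S le C x" for C x
  proof -
    obtain c where c: "c \<in> C" using C(1) by blast
    have "le (star s) c" "c \<in> S" "le c x" using c C AQ QS x by (auto simp: A_def supremum_in_def)
    then have "le (star s) x" using le_trans sQ QS x(1) by blast
    moreover have "nested le star x t" if "t \<in> T" "nested le star s t" for t
    proof (rule nested_chain_supremum[OF _ _ C(3) x(2)])
      show "t \<in> S" "C \<subseteq> S" using that TS C AQ QS by auto
      show "nested le star c t" if "c \<in> C" for c
        using that \<open>t \<in> T\<close> \<open>nested le star s t\<close> C(2) by (auto simp: A_def)
    qed
    ultimately show ?thesis using x by (simp add: A_def)
  qed
  ultimately obtain y where y: "maximal_in le A y"
    using closed_above_maximal[OF QS closed[OF PQ(2)] AQ] by blast
  have yA: "y \<in> A" and ymax: "\<And>a. \<lbrakk>a \<in> A; le y a\<rbrakk> \<Longrightarrow> a = y"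
    using y by (auto simp: maximal_in_def)
  have yQ: "y \<in> Q" and sy: "le (star s) y"
    and ynest: "\<And>t. \<lbrakk>t \<in> T; nested le star s t\<rbrakk> \<Longrightarrow> nested le star y t"
    using yA by (auto simp: A_def)
  have yS: "y \<in> S" using yQ QS by blast
  have yP: "star y \<in> P"
    using profile_distinguish_upward[OF Q P sQ _ yQ sy] sP star_star[OF sS] by simp
  have ys: "le (star y) s"
    using star_le[OF sy _ yS] star_closed[OF sS] star_star[OF sS] by simp
  have inside: "nested le star y t" if t: "t \<in> T" "t \<in> P" for t
  proof (rule ccontr)
    assume cross: "\<not> nested le star y t"
    then have scross: "\<not> nested le star s t" using ynest t by blast
    have tQ: "t \<in> Q" using same t by blast
    have tS: "t \<in> S" using t TS by blast
    obtain R where R: "R \<in> Ps" "star t \<in> R"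
      using T(1)[OF t(1)] unfolding relevant_def by blast
    note R' = profiles[OF R(1)]
    have "star s \<notin> R"
    proof
      assume "star s \<in> R"
      then obtain u where u: "u \<in> P" "supremum_in S le {s, t} u"
        using orderly_corner[OF PQ(1) R(1) sP t(2) _ R(2)] by blast
      then have "u = s" "le t u" using smax by (auto simp: supremum_in_def)
      then show False using scross nested_iff[OF sS tS] by blast
    qed
    then have sR: "s \<in> R" using profile_total[OF R' sS] by blast
    (* The exceptional case of downward closure would put s and its inverse into P. *)
    have "star y \<noteq> star s" using yP sP profile_not_both[OF P] by auto
    then have "star y \<in> R" using profile_downward[OF R' sR star_closed[OF yS] ys] by blast
    then obtain u where u: "u \<in> Q" "supremum_in S le {y, t} u"
      using orderly_corner[OF PQ(2) R(1) yQ tQ _ R(2)] by blast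
    then have yu: "le y u" "le t u" by (auto simp: supremum_in_def)
    have "le (star s) u" using le_trans[OF sy yu(1)] sQ QS yQ u(1) by blast
    moreover have "nested le star u v" if "v \<in> T" "nested le star s v" for v
      using nested_corner[OF _ yS tS u(2) cross] ynest T(3) t(1) that TS by blast
    ultimately have "u \<in> A" using u(1) by (simp add: A_def)
    then have "u = y" using ymax yu(1) by blast
    then show False using cross yu(2) nested_iff[OF yS tS] by blast
  qed
  have "nested le star y t" if t: "t \<in> T" for t
  proof (cases "t \<in> P")
    case False
    then have "star t \<in> P" using profile_total[OF P] t TS by blast
    then show ?thesis using inside[OF T(2)[OF t]] nested_star_right t TS by blast
  qed (use inside t in blast)
  then show ?thesis using yQ yP by blast
qed

section \<open>Maximal nested sets of relevant separations\<close>

definition nested_relevant :: "'a set \<Rightarrow> bool" where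
  "nested_relevant T \<longleftrightarrow>
     (\<forall>t\<in>T. relevant Ps star t) \<and> (\<forall>t\<in>T. \<forall>u\<in>T. nested le star t u)"

lemma maximal_nested_relevant_exists:
  "\<exists>T. nested_relevant T \<and>
     (\<forall>x. relevant Ps star x \<longrightarrow> (\<forall>t\<in>T. nested le star x t) \<longrightarrow> x \<in> T)"
proof -
  have "\<Union>C \<in> Collect nested_relevant" if "subset.chain (Collect nested_relevant) C" for C
  proof -
    have C: "\<And>A. A \<in> C \<Longrightarrow> nested_relevant A" "\<And>A B. \<lbrakk>A \<in> C; B \<in> C\<rbrakk> \<Longrightarrow> A \<subseteq> B \<or> B \<subseteq> A"
      using that by (auto simp: subset_chain_def)
    have "nested le star t u" if "t \<in> A" "A \<in> C" "u \<in> B" "B \<in> C" for t u A B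
      using C(1)[OF that(2)] C(1)[OF that(4)] C(2)[OF that(2,4)] that
      unfolding nested_relevant_def by blast
    then show ?thesis using C(1) unfolding nested_relevant_def by blast
  qed
  then obtain T where T: "nested_relevant T"
      "\<And>U. \<lbrakk>nested_relevant U; T \<subseteq> U\<rbrakk> \<Longrightarrow> U = T"
    using subset_Zorn'[of "Collect nested_relevant"] by auto
  have "x \<in> T" if x: "relevant Ps star x" "\<forall>t\<in>T. nested le star x t" for x
  proof -
    have "nested le star x x"
      using relevant_in_S[OF x(1)] le_refl nested_iff by blast
    then have "nested_relevant (insert x T)"
      using T(1) x nested_commute unfolding nested_relevant_def by blast
    then show ?thesis using T(2) by blast
  qed
  then show ?thesis using T(1) by blast
qed

text \<open>If \<open>s\<close> is trivial, witnessed by \<open>r\<close>, then consistency puts \<open>s\<close> into every profile, whichever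
  way that profile orients \<open>r\<close>.\<close>

lemma relevant_not_trivial:
  assumes "relevant Ps star s" "T \<subseteq> S"
  shows "\<not> trivial_in T le star s"
proof
  assume "trivial_in T le star s"
  then obtain r where r: "r \<in> S" "le s r" "s \<noteq> r" "le s (star r)" "s \<noteq> star r"
    using assms(2) by (auto simp: trivial_in_def strictly_below_def)
  obtain Q where Q: "Q \<in> Ps" "star s \<in> Q" using assms(1) by (auto simp: relevant_def)
  note Q' = profiles[OF Q(1)]
  have sS: "s \<in> S" using assms(1) by (rule relevant_in_S)
  have "s \<in> Q"
  proof (cases "r \<in> Q")
    case True
    then show ?thesis using profile_downward[OF Q' _ sS] r by blast
  next
    case False
    then have "star r \<in> Q" using profile_total[OF Q' r(1)] by blast
    then show ?thesis using profile_downward[OF Q' _ sS] r star_star by auto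
  qed
  then show False using profile_not_both[OF Q'] Q(2) by blast
qed

lemma profile_not_degenerate:
  assumes "P \<in> Ps" "s \<in> S"
  shows "s \<noteq> star s"
  using assms profiles profile_total profile_not_both by metis

lemma tree_set_exists:
  "\<exists>T. T \<subseteq> S \<and> tree_set T le star \<and>
    (\<forall>P\<in>Ps. \<forall>Q\<in>Ps. P \<noteq> Q \<longrightarrow> (\<exists>s\<in>T. distinguishes star s P Q)) \<and>
    (\<forall>s\<in>T. \<exists>P\<in>Ps. \<exists>Q\<in>Ps. P \<noteq> Q \<and> distinguishes star s P Q) \<and>
    (\<forall>P\<in>Ps. \<forall>s\<in>P \<inter> T. \<exists>m. maximal_in le (P \<inter> T) m \<and> le s m)"
proof -
  obtain T where T: "nested_relevant T"
    and Tmax: "\<And>x. \<lbrakk>relevant Ps star x; \<forall>t\<in>T. nested le star x t\<rbrakk> \<Longrightarrow> x \<in> T"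
    using maximal_nested_relevant_exists by blast
  have Trel: "\<And>t. t \<in> T \<Longrightarrow> relevant Ps star t"
    and Tnest: "\<And>t u. \<lbrakk>t \<in> T; u \<in> T\<rbrakk> \<Longrightarrow> nested le star t u"
    using T by (auto simp: nested_relevant_def)
  have TS: "T \<subseteq> S" using Trel relevant_in_S by blast
  have Tstar: "star t \<in> T" if "t \<in> T" for t
    using Tmax[OF relevant_star[OF Trel[OF that]]] Tnest that TS nested_star_left by blast
  have nondeg: "t \<noteq> star t" if "t \<in> T" for t
    using Trel[OF that] TS that profile_not_degenerate unfolding relevant_def by blast
  have "tree_set T le star"
    unfolding tree_set_def degenerate_def
    using separation_system_subset[OF TS Tstar] Tnest Trel relevant_not_trivial[OF _ TS] nondeg
    by blast
  moreover have "\<exists>s\<in>T. distinguishes star s P Q" if PQ: "P \<in> Ps" "Q \<in> Ps" "P \<noteq> Q" for P Q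
  proof (cases "T \<inter> P \<subseteq> Q")
    case True
    then obtain y where y: "y \<in> Q" "star y \<in> P" "\<forall>t\<in>T. nested le star y t"
      using nested_distinguisher_exists[OF Trel Tstar Tnest PQ] by blast
    then have "y \<in> T" using Tmax PQ unfolding relevant_def by blast
    then show ?thesis using y nondeg unfolding distinguishes_def by blast
  next
    case False
    then obtain t where "t \<in> T" "t \<in> P" "t \<notin> Q" by blast
    moreover from this have "star t \<in> Q" using profile_total[OF profiles[OF PQ(2)]] TS by blast
    ultimately show ?thesis using nondeg unfolding distinguishes_def by blast
  qed
  moreover have "\<exists>P\<in>Ps. \<exists>Q\<in>Ps. P \<noteq> Q \<and> distinguishes star s P Q" if s: "s \<in> T" for s
  proof -
    obtain P Q where PQ: "P \<in> Ps" "Q \<in> Ps" "s \<in> P" "star s \<in> Q"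
      using Trel[OF s] unfolding relevant_def by blast
    then have "P \<noteq> Q" using profiles profile_not_both by blast
    then show ?thesis using PQ nondeg[OF s] unfolding distinguishes_def by blast
  qed
  moreover have "\<exists>m. maximal_in le (P \<inter> T) m \<and> le s m" if P: "P \<in> Ps" and s: "s \<in> P \<inter> T" for P s
  proof (rule closed_above_maximal[OF _ closed[OF P] _ s])
    show "P \<subseteq> S" using profile_subset[OF profiles[OF P]] .
    fix C x
    assume C: "C \<noteq> {}" "C \<subseteq> P \<inter> T" "Complete_Partial_Order.chain le C"
      and x: "x \<in> P" "supremum_in S le C x"
    obtain c where c: "c \<in> C" using C(1) by blast
    have "le c x" using c x by (simp add: supremum_in_def)
    then have "relevant Ps star x"
      using relevant_upward[OF Trel P _ x(1)] c C(2) by blast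
    moreover have "nested le star x t" if "t \<in> T" for t
      using nested_chain_supremum[OF _ _ C(3) x(2)] that C(2) TS Tnest by blast
    ultimately show "x \<in> P \<inter> T" using Tmax x(1) by blast
  qed simp
  ultimately show ?thesis using TS by (intro exI[of _ T]) simp
qed

end

theorem corollary4p8:
  fixes S :: "'a set"
    and le :: "'a \<Rightarrow> 'a \<Rightarrow> bool"
    and star :: "'a \<Rightarrow> 'a"
    and vee :: "'a \<times> 'a \<rightharpoonup> 'a"
    and Ps :: "'a set set"
  assumes "separation_system_corner S le star vee"
    and "\<And>P. P \<in> Ps \<Longrightarrow> profile S le star vee P \<and> closed_in S le P"
    and "orderly S star vee Ps"
  shows "\<exists>T. T \<subseteq> S \<and> tree_set T le star \<and>
    (\<forall>P\<in>Ps. \<forall>Q\<in>Ps. P \<noteq> Q \<longrightarrow> (\<exists>s\<in>T. distinguishes star s P Q)) \<and>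
    (\<forall>s\<in>T. \<exists>P\<in>Ps. \<exists>Q\<in>Ps. P \<noteq> Q \<and> distinguishes star s P Q) \<and>
    (\<forall>P\<in>Ps. \<forall>s\<in>P \<inter> T. \<exists>m. maximal_in le (P \<inter> T) m \<and> le s m)"
proof -
  interpret separation_system_corner S le star vee by (rule assms(1))
  interpret orderly_closed_profiles S le star vee Ps
    using assms(2,3) by unfold_locales blast+
  show ?thesis by (rule tree_set_exists)
qed

end
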